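(* Let $G=(V,E)$ be a locally finite simple graph and $x\in V$. Then the curvature function $\mathcal K_{G,x}:(0,\infty]\to\mathbb R$ has the following properties: (i) $\mathcal K_{G,x}$ is monotone non-decreasing. (ii) $\mathcal K_{G,x}$ is continuous. (iii) For any $\mathcal N\in(0,\infty]$, $$\mathcal K_{G,x}(\infty)-\frac{2d_x}{\mathcal N}\le\mathcal K_{G,x}(\mathcal N)\le\mathcal K_\infty^0(x)-\frac{2d_x}{\mathcal N}.$$ In particular, $\lim_{\mathcal N\to0}\mathcal K_{G,x}(\mathcal N)=-\infty$. (iv) $\mathcal K_{G,x}$ is a concave function.
   Context: Graphs are undirected, without loops or multiple edges, and every vertex has finite degree; $d_x$ is the degree of $x$, and the vertex $x$ considered has $d_x\ge1$. For $f:V\to\mathbb R$ put $\Delta f(x)=\sum_{y\sim x}(f(y)-f(x))$ (non-normalized Laplacian), and for $f,g:V\to\mathbb R$ put $2\Gamma(f,g)=\Delta(fg)-f\Delta g-g\Delta f$, $2\Gamma_2(f,g)=\Delta\Gamma(f,g)-\Gamma(f,\Delta g)-\Gamma(\Delta f,g)$, $\Gamma(f)=\Gamma(f,f)$, $\Gamma_2(f)=\Gamma_2(f,f)$. For $\mathcal N\in(0,\infty]$ (convention $1/\infty=0$), $\mathcal K_{G,x}(\mathcal N)$ is the largest $K\in\mathbb R$ such that $\Gamma_2(f)(x)\ge\frac1{\mathcal N}(\Delta f(x))^2+K\,\Gamma(f)(x)$ for all $f:V\to\mathbb R$ (Bakry-Émery curvature function). $S_1(x)$ is the set of neighbours of $x$.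 For $y\in S_1(x)$, the out degree $d_y^+$ is the number of neighbours of $y$ at graph distance $2$ from $x$; $av_1^+(x)=\frac1{d_x}\sum_{y\in S_1(x)}d_y^+$; and $\mathcal K_\infty^0(x)=\frac{3+d_x-av_1^+(x)}2$. Continuity on $(0,\infty]$ includes $\lim_{\mathcal N\to\infty}\mathcal K_{G,x}(\mathcal N)=\mathcal K_{G,x}(\infty)$. Concavity means $\mathcal K_{G,x}(\alpha\mathcal N_1+(1-\alpha)\mathcal N_2)\ge\alpha\mathcal K_{G,x}(\mathcal N_1)+(1-\alpha)\mathcal K_{G,x}(\mathcal N_2)$ for finite $\mathcal N_1,\mathcal N_2>0$ and $\alpha\in[0,1]$. *)

theory Defs
  imports "HOL-Analysis.Analysis"
begin

text \<open>An undirected graph is given by its vertex set and its adjacency relation, a symmetric set of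
  ordered pairs; thus \<open>E `` {x}\<close> is the set \<open>S\<^sub>1(x)\<close> of neighbours of \<open>x\<close>.\<close>

locale locally_finite_simple_graph =
  fixes V :: "'a set" and E :: "('a \<times> 'a) set"
  assumes edges_in_verts: "E \<subseteq> V \<times> V"
    and sym_edges: "sym E"
    and no_loops: "irrefl E"
    and locally_finite: "\<And>x. x \<in> V \<Longrightarrow> finite (E `` {x})"

definition vdegree :: "('a \<times> 'a) set \<Rightarrow> 'a \<Rightarrow> nat" where
  "vdegree E x = card (E `` {x})"

text \<open>The distance is the infimum of the lengths of walks from \<open>x\<close> to \<open>y\<close>, and \<open>\<infinity>\<close> if there is
  none.\<close>

definition graph_dist :: "('a \<times> 'a) set \<Rightarrow> 'a \<Rightarrow> 'a \<Rightarrow> enat" where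
  "graph_dist E x y = (INF n \<in> {n. (x, y) \<in> E ^^ n}. enat n)"

text \<open>Functions on vertices are total functions on the ambient type. At a vertex, the operators
  below depend only on values at vertices, because edges join vertices.\<close>

definition laplacian :: "('a \<times> 'a) set \<Rightarrow> ('a \<Rightarrow> real) \<Rightarrow> 'a \<Rightarrow> real" where
  "laplacian E f x = (\<Sum>y \<in> E `` {x}. f y - f x)"

definition Gamma_form :: "('a \<times> 'a) set \<Rightarrow> ('a \<Rightarrow> real) \<Rightarrow> ('a \<Rightarrow> real) \<Rightarrow> 'a \<Rightarrow> real" where
  "Gamma_form E f g x =
     (laplacian E (\<lambda>z. f z * g z) x - f x * laplacian E g x - g x * laplacian E f x) / 2"

definition Gamma2_form :: "('a \<times> 'a) set \<Rightarrow> ('a \<Rightarrow> real) \<Rightarrow> ('a \<Rightarrow> real) \<Rightarrow> 'a \<Rightarrow> real" where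
  "Gamma2_form E f g x =
     (laplacian E (Gamma_form E f g) x
       - Gamma_form E f (laplacian E g) x - Gamma_form E (laplacian E f) g x) / 2"

text \<open>The dimension ranges over the positive extended reals; \<open>1 / \<infinity> = 0\<close> holds in \<^typ>\<open>ereal\<close>.\<close>

definition curvature_dimension :: "('a \<times> 'a) set \<Rightarrow> 'a \<Rightarrow> ereal \<Rightarrow> real \<Rightarrow> bool" where
  "curvature_dimension E x N K \<longleftrightarrow>
     (\<forall>f :: 'a \<Rightarrow> real. Gamma2_form E f f x
        \<ge> real_of_ereal (1 / N) * (laplacian E f x)\<^sup>2 + K * Gamma_form E f f x)"

definition curvature_function :: "('a \<times> 'a) set \<Rightarrow> 'a \<Rightarrow> ereal \<Rightarrow> real" where
  "curvature_function E x N = (GREATEST K. curvature_dimension E x N K)"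

definition out_degree :: "('a \<times> 'a) set \<Rightarrow> 'a \<Rightarrow> 'a \<Rightarrow> nat" where
  "out_degree E x y = card {z \<in> E `` {y}. graph_dist E x z = 2}"

definition av_out_degree :: "('a \<times> 'a) set \<Rightarrow> 'a \<Rightarrow> real" where
  "av_out_degree E x = (\<Sum>y \<in> E `` {x}. real (out_degree E x y)) / real (vdegree E x)"

definition K0_infinity :: "('a \<times> 'a) set \<Rightarrow> 'a \<Rightarrow> real" where
  "K0_infinity E x = (3 + real (vdegree E x) - av_out_degree E x) / 2"

end

theory Submission
  imports Defs
begin

text \<open>Completing squares gives
  \<open>4 \<Gamma>\<^sub>2(f)(x) = \<Sum>\<^sub>y \<Sum>\<^sub>z (f z - 2 f y + f x)\<^sup>2 - \<Sum>\<^sub>y (d\<^sub>y + d\<^sub>x) (f y - f x)\<^sup>2 + 2 (\<Delta> f(x))\<^sup>2\<close>,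
  where \<open>y\<close> runs over the neighbours of \<open>x\<close> and \<open>z\<close> over those of \<open>y\<close>. Hence \<open>\<Gamma>\<^sub>2\<close> is bounded
  below by a multiple of \<open>\<Gamma>\<close>, while the function that is \<open>0\<close> at \<open>x\<close>, \<open>1\<close> on the neighbours and
  \<open>2\<close> elsewhere gives the upper bound in (iii); so the largest \<open>K\<close> exists. By Cauchy-Schwarz,
  \<open>(\<Delta> f(x))\<^sup>2 \<le> 2 d\<^sub>x \<Gamma>(f)(x)\<close>, so the curvature is Lipschitz in \<open>1/N\<close> with constant \<open>2 d\<^sub>x\<close>.
  Concavity follows from convexity of \<open>t \<mapsto> 1/t\<close>.\<close>

section \<open>Carre du champ forms as sums over edges\<close>

lemma Gamma_form_eq_sum:
  "Gamma_form E f g x = (\<Sum>y \<in> E `` {x}. (f y - f x) * (g y - g x)) / 2"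
proof -
  have "(\<Sum>y \<in> E `` {x}. (f y - f x) * (g y - g x))
      = (\<Sum>y \<in> E `` {x}. (f y * g y - f x * g x) - f x * (g y - g x) - g x * (f y - f x))"
    by (rule sum.cong) (auto simp: algebra_simps)
  then show ?thesis
    unfolding Gamma_form_def laplacian_def sum_subtractf[of _ _ "E `` {x}"]
      sum_distrib_left[symmetric] by simp
qed

lemma Gamma_form_self:
  "Gamma_form E f f x = (\<Sum>y \<in> E `` {x}. (f y - f x)\<^sup>2) / 2"
  by (simp add: Gamma_form_eq_sum power2_eq_square)

lemma Gamma_form_nonneg: "Gamma_form E f f x \<ge> 0"
  by (simp add: Gamma_form_self sum_nonneg)

text \<open>Each second difference is \<open>(f z - f y) - (f y - f x)\<close>. Its square, summed
  over \<open>z\<close>, yields the terms that \<open>\<Delta> \<Gamma>(f)\<close> and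
  \<open>\<Gamma>(f, \<Delta> f)\<close> contribute at \<open>y\<close>, up to a multiple of
  \<open>(f y - f x)\<^sup>2\<close>.\<close>

lemma Gamma2_form_self:
  "4 * Gamma2_form E f f x =
     (\<Sum>y \<in> E `` {x}. \<Sum>z \<in> E `` {y}. (f z - 2 * f y + f x)\<^sup>2)
     - (\<Sum>y \<in> E `` {x}. (real (vdegree E y) + real (vdegree E x)) * (f y - f x)\<^sup>2)
     + 2 * (laplacian E f x)\<^sup>2"
proof -
  let ?S = "E `` {x}" and ?d = "real (vdegree E x)"
  have sq: "(\<Sum>z \<in> E `` {y}. (f z - 2 * f y + f x)\<^sup>2) =
      2 * Gamma_form E f f y - 2 * (f y - f x) * laplacian E f y
      + real (vdegree E y) * (f y - f x)\<^sup>2" for y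
  proof -
    have "(\<Sum>z \<in> E `` {y}. (f z - 2 * f y + f x)\<^sup>2) =
      (\<Sum>z \<in> E `` {y}. (f z - f y)\<^sup>2 - 2 * (f y - f x) * (f z - f y) + (f y - f x)\<^sup>2)"
      by (rule sum.cong) (auto simp: power2_eq_square algebra_simps)
    also have "\<dots> = (\<Sum>z \<in> E `` {y}. (f z - f y)\<^sup>2) - 2 * (f y - f x) * laplacian E f y
        + real (vdegree E y) * (f y - f x)\<^sup>2"
      unfolding sum.distrib sum_subtractf laplacian_def vdegree_def sum_distrib_left[symmetric]
      by simp
    finally show ?thesis
      by (simp add: Gamma_form_self)
  qed
  have comm: "Gamma_form E (laplacian E f) f x = Gamma_form E f (laplacian E f) x"
    by (simp add: Gamma_form_eq_sum mult.commute)
  have G: "Gamma_form E f (laplacian E f) x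
     = ((\<Sum>y\<in>?S. (f y - f x) * laplacian E f y) - (laplacian E f x)\<^sup>2) / 2"
    by (simp only: Gamma_form_eq_sum right_diff_distrib sum_subtractf[where A = ?S]
        power2_eq_square sum_distrib_right[symmetric] laplacian_def[of E f x])
  have L: "laplacian E (Gamma_form E f f) x
     = (\<Sum>y\<in>?S. Gamma_form E f f y) - ?d * Gamma_form E f f x"
    by (simp add: laplacian_def[of E "Gamma_form E f f"] sum_subtractf vdegree_def)
  have D: "(\<Sum>y\<in>?S. (real (vdegree E y) + ?d) * (f y - f x)\<^sup>2)
     = (\<Sum>y\<in>?S. real (vdegree E y) * (f y - f x)\<^sup>2) + 2 * ?d * Gamma_form E f f x"
    by (simp add: distrib_right sum.distrib Gamma_form_self flip: sum_distrib_left)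
  show ?thesis
    unfolding Gamma2_form_def comm G L D sq sum.distrib sum_subtractf mult.assoc
      sum_distrib_left[symmetric]
    by (simp add: field_simps)
qed

lemma laplacian_sq_le: "(laplacian E f x)\<^sup>2 \<le> 2 * real (vdegree E x) * Gamma_form E f f x"
  using Cauchy_Schwarz_ineq_sum[of "\<lambda>_. 1" "\<lambda>y. f y - f x" "E `` {x}"]
  by (simp add: laplacian_def Gamma_form_self vdegree_def)

section \<open>Curvature-dimension inequalities under a change of dimension\<close>

lemma real_of_ereal_one_divide: "real_of_ereal (1 / ereal t) = 1 / t"
  by (simp add: divide_ereal_def inverse_eq_divide)

lemma inverse_dimension_nonneg: "N > 0 \<Longrightarrow> real_of_ereal (1 / N) \<ge> 0"
  by (cases N) (auto simp: real_of_ereal_one_divide)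

lemma inverse_dimension_antimono:
  assumes "0 < M" "M \<le> N"
  shows "real_of_ereal (1 / N) \<le> real_of_ereal (1 / M)"
  using assms by (cases M; cases N) (auto simp: frac_le real_of_ereal_one_divide)

text \<open>\<open>N\<close> enters only through \<open>1 / N\<close>, and both \<open>1 / N\<close>
  and \<open>K\<close> multiply nonnegative quantities. Comparing inverses treats
  \<open>\<infinity>\<close> like the finite dimensions.\<close>

lemma curvature_dimension_mono:
  assumes "curvature_dimension E x M K" "L \<le> K"
    and "real_of_ereal (1 / N) \<le> real_of_ereal (1 / M)"
  shows "curvature_dimension E x N L"
  unfolding curvature_dimension_def
proof
  fix f :: "'a \<Rightarrow> real"
  have "real_of_ereal (1 / N) * (laplacian E f x)\<^sup>2 + L * Gamma_form E f f x
      \<le> real_of_ereal (1 / M) * (laplacian E f x)\<^sup>2 + K * Gamma_form E f f x"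
    using assms by (intro add_mono mult_right_mono Gamma_form_nonneg) auto
  also have "\<dots> \<le> Gamma2_form E f f x"
    using assms(1) by (auto simp: curvature_dimension_def)
  finally show "real_of_ereal (1 / N) * (laplacian E f x)\<^sup>2 + L * Gamma_form E f f x
    \<le> Gamma2_form E f f x" .
qed

text \<open>Raising the inverse dimension costs a multiple of the squared Laplacian, which
  \<open>laplacian_sq_le\<close> trades for a multiple of \<open>\<Gamma>(f)\<close>, that is, for a
  smaller \<open>K\<close>.\<close>

lemma curvature_dimension_shift:
  assumes "curvature_dimension E x M K"
    and "real_of_ereal (1 / M) \<le> real_of_ereal (1 / N)"
  shows "curvature_dimension E x N
    (K - 2 * real (vdegree E x) * (real_of_ereal (1 / N) - real_of_ereal (1 / M)))"
  unfolding curvature_dimension_def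
proof
  fix f :: "'a \<Rightarrow> real"
  let ?s = "real_of_ereal (1 / N)" and ?r = "real_of_ereal (1 / M)"
  have "(?s - ?r) * (laplacian E f x)\<^sup>2 \<le> (?s - ?r) * (2 * real (vdegree E x) * Gamma_form E f f x)"
    using assms(2) laplacian_sq_le by (intro mult_left_mono) auto
  moreover have "?r * (laplacian E f x)\<^sup>2 + K * Gamma_form E f f x \<le> Gamma2_form E f f x"
    using assms(1) by (auto simp: curvature_dimension_def)
  ultimately show "?s * (laplacian E f x)\<^sup>2
      + (K - 2 * real (vdegree E x) * (?s - ?r)) * Gamma_form E f f x \<le> Gamma2_form E f f x"
    by (simp add: algebra_simps)
qed

text \<open>In the convex combination of the two inequalities for the same \<open>f\<close>, the
  squared Laplacian has coefficient \<open>u / s + v / t\<close>, which is at least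
  \<open>1 / (u * s + v * t)\<close>.\<close>

lemma curvature_dimension_convex:
  fixes s t u v K L :: real
  assumes "curvature_dimension E x (ereal s) K" "curvature_dimension E x (ereal t) L"
    and "0 < s" "0 < t" "0 \<le> u" "0 \<le> v" "u + v = 1"
  shows "curvature_dimension E x (ereal (u * s + v * t)) (u * K + v * L)"
  unfolding curvature_dimension_def
proof
  fix f :: "'a \<Rightarrow> real"
  let ?D = "(laplacian E f x)\<^sup>2" and ?G = "Gamma_form E f f x" and ?G2 = "Gamma2_form E f f x"
  have inv: "1 / (u * s + v * t) \<le> u * (1 / s) + v * (1 / t)"
    using convex_onD[OF convex_on_inverse[of "{0<..}"], of v s t] assms
    by (simp add: eq_diff_eq[symmetric] inverse_eq_divide)
  have "1 / (u * s + v * t) * ?D \<le> (u * (1 / s) + v * (1 / t)) * ?D"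
    using inv by (rule mult_right_mono) simp
  moreover have "u * (1 / s * ?D + K * ?G) \<le> u * ?G2" "v * (1 / t * ?D + L * ?G) \<le> v * ?G2"
    using assms unfolding curvature_dimension_def real_of_ereal_one_divide
    by (auto intro!: mult_left_mono)
  moreover have "u * ?G2 + v * ?G2 = ?G2"
    using assms by (simp flip: distrib_right)
  ultimately show "real_of_ereal (1 / ereal (u * s + v * t)) * ?D + (u * K + v * L) * ?G \<le> ?G2"
    by (simp add: real_of_ereal_one_divide distrib_right distrib_left mult.assoc)
qed

text \<open>The walk through \<open>y\<close> bounds the distance by 2, and only walks of length 0
  or 1 could be shorter.\<close>

lemma graph_dist_eq_2_iff:
  assumes "(x, y) \<in> E" "(y, z) \<in> E"
  shows "graph_dist E x z = 2 \<longleftrightarrow> z \<noteq> x \<and> z \<notin> E `` {x}"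
proof -
  let ?A = "{n. (x, z) \<in> E ^^ n}"
  have two: "(x, z) \<in> E ^^ 2"
    using assms by (auto simp: numeral_2_eq_2)
  show ?thesis
  proof (intro iffI conjI notI)
    assume dist: "graph_dist E x z = 2"
    have le: "2 \<le> enat n" if "n \<in> ?A" for n
      using INF_lower[OF that, of enat] dist by (simp add: graph_dist_def)
    show False if "z = x"
      using le[of 0] that by (simp add: zero_enat_def[symmetric])
    show False if "z \<in> E `` {x}"
      using le[of 1] that by (simp add: one_enat_def[symmetric])
  next
    assume far: "z \<noteq> x \<and> z \<notin> E `` {x}"
    show "graph_dist E x z = 2"
      unfolding graph_dist_def
    proof (rule antisym)
      show "(INF n\<in>?A. enat n) \<le> 2"
        using INF_lower[of 2 ?A enat] two by (simp add: numeral_eq_enat)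
      show "2 \<le> (INF n\<in>?A. enat n)"
      proof (rule INF_greatest)
        fix n assume "n \<in> ?A"
        then have "n \<noteq> 0" "n \<noteq> 1" using far by (auto intro!: Nat.gr0I)
        then show "2 \<le> enat n" by (simp add: numeral_eq_enat)
      qed
    qed
  qed
qed

section \<open>Admissible constants: existence, upper bound, attained maximum\<close>

context locally_finite_simple_graph
begin

lemma finite_neighbours: "(x, y) \<in> E \<Longrightarrow> finite (E `` {y})"
  using edges_in_verts locally_finite by blast

lemma finite_neighbours_self: "finite (E `` {x})"
proof (cases "x \<in> V")
  case False
  then have "E `` {x} = {}" using edges_in_verts by auto
  then show ?thesis by simp
qed (rule locally_finite)

lemma ex_curvature_dimension: "\<exists>K. curvature_dimension E x N K"
proof -
  let ?d = "real (vdegree E x)"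
  define s where "s = real_of_ereal (1 / N)"
  \<comment> \<open>\<open>D\<close> dominates the degree of every neighbour, so the negative sum in
    \<open>Gamma2_form_self\<close> is at most \<open>2 * (D + ?d)\<close> times
    \<open>\<Gamma>(f)\<close>; division by 4 gives the first term of \<open>K\<close>. The second
    absorbs \<open>s\<close> times the squared Laplacian, with \<open>\<bar>s\<bar>\<close> because
    \<open>N\<close> may be negative.\<close>
  define D where "D = (\<Sum>y \<in> E `` {x}. real (vdegree E y))"
  define K where "K = - (D + ?d) / 2 - 2 * ?d * \<bar>s\<bar>"
  have "s * (laplacian E f x)\<^sup>2 + K * Gamma_form E f f x \<le> Gamma2_form E f f x" for f
  proof -
    have "(\<Sum>y \<in> E `` {x}. (real (vdegree E y) + ?d) * (f y - f x)\<^sup>2)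
        \<le> (\<Sum>y \<in> E `` {x}. (D + ?d) * (f y - f x)\<^sup>2)"
      unfolding D_def using finite_neighbours_self
      by (intro sum_mono mult_right_mono add_right_mono member_le_sum) auto
    also have "\<dots> = 2 * (D + ?d) * Gamma_form E f f x"
      by (simp add: Gamma_form_self flip: sum_distrib_left)
    finally have "(\<Sum>y \<in> E `` {x}. (real (vdegree E y) + ?d) * (f y - f x)\<^sup>2)
        \<le> 2 * (D + ?d) * Gamma_form E f f x" .
    moreover have "0 \<le> (\<Sum>y \<in> E `` {x}. \<Sum>z \<in> E `` {y}. (f z - 2 * f y + f x)\<^sup>2)"
      by (intro sum_nonneg) auto
    ultimately have "- (2 * (D + ?d) * Gamma_form E f f x) \<le> 4 * Gamma2_form E f f x"
      using zero_le_power2[of "laplacian E f x"] unfolding Gamma2_form_self by linarith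
    moreover have "s * (laplacian E f x)\<^sup>2 \<le> \<bar>s\<bar> * (2 * ?d * Gamma_form E f f x)"
      using laplacian_sq_le by (intro mult_mono) auto
    ultimately show ?thesis
      by (simp add: K_def field_simps)
  qed
  then show ?thesis
    unfolding curvature_dimension_def s_def[symmetric] by blast
qed

text \<open>Neighbours of \<open>y\<close> have distance 0, 1 or 2 from \<open>x\<close>: they are
  \<open>x\<close> itself, the third vertices of triangles on the edge, and the outward
  neighbours.\<close>

lemma vdegree_neighbour_split:
  assumes "(x, y) \<in> E"
  shows "vdegree E y = 1 + card (E `` {y} \<inter> E `` {x}) + out_degree E x y"
proof -
  let ?T = "E `` {y} \<inter> E `` {x}" and ?U = "{z \<in> E `` {y}. graph_dist E x z = 2}"
  have "x \<notin> E `` {x}" using no_loops by (auto simp: irrefl_def)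
  have "(y, x) \<in> E" using assms sym_edges by (auto dest: symD)
  have eq: "E `` {y} = {x} \<union> ?T \<union> ?U"
    using graph_dist_eq_2_iff[OF assms] \<open>(y, x) \<in> E\<close> by auto
  have disj: "({x} \<union> ?T) \<inter> ?U = {}" "{x} \<inter> ?T = {}"
    using graph_dist_eq_2_iff[OF assms] \<open>x \<notin> E `` {x}\<close> by auto
  have fin: "finite ?T" "finite ?U"
    using finite_neighbours[OF assms] by (auto intro: rev_finite_subset)
  have "card ({x} \<union> ?T \<union> ?U) = card ({x} \<union> ?T) + card ?U"
    using disj fin by (intro card_Un_disjoint) auto
  also have "card ({x} \<union> ?T) = 1 + card ?T"
    using disj fin by (subst card_Un_disjoint) auto
  finally show ?thesis
    unfolding vdegree_def out_degree_def eq[symmetric] .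
qed

lemma curvature_dimension_le_K0:
  assumes "vdegree E x \<ge> 1" and "curvature_dimension E x N K"
  shows "K \<le> K0_infinity E x - 2 * real (vdegree E x) * real_of_ereal (1 / N)"
proof -
  let ?d = "real (vdegree E x)" and ?s = "real_of_ereal (1 / N)"
  \<comment> \<open>On the neighbourhoods involved this is the distance from \<open>x\<close>. Its
    second differences vanish along outward edges, and its constant increments at \<open>x\<close>
    give equality in Cauchy-Schwarz, hence the exact term \<open>2 * ?d * ?s\<close>.\<close>
  define f where "f z = (if z = x then 0 else if z \<in> E `` {x} then 1 else (2 :: real))" for z
  have nx: "x \<notin> E `` {x}" using no_loops by (auto simp: irrefl_def)
  then have f1: "f y = 1" if "y \<in> E `` {x}" for y
    using that by (auto simp: f_def)
  have f0: "f x = 0" by (simp add: f_def)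
  have L: "laplacian E f x = ?d"
    by (simp add: laplacian_def f0 f1 vdegree_def)
  have G: "Gamma_form E f f x = ?d / 2"
    by (simp add: Gamma_form_self f0 f1 vdegree_def)
  \<comment> \<open>The vertex \<open>x\<close> contributes 4, each common neighbour 1, each outward
    neighbour 0; the degree split then eliminates the number of common neighbours.\<close>
  have sq: "(\<Sum>z \<in> E `` {y}. (f z - 2)\<^sup>2)
      = real (vdegree E y) + 3 - real (out_degree E x y)" if y: "y \<in> E `` {x}" for y
  proof -
    have fin: "finite (E `` {y})" using y finite_neighbours by auto
    have yx: "x \<in> E `` {y}" using y sym_edges by (auto dest: symD)
    have "(\<Sum>z \<in> E `` {y}. (f z - 2)\<^sup>2)
        = (\<Sum>z \<in> E `` {y}. (if z = x then 4 else 0) + (if z \<in> E `` {x} then 1 else 0))"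
      using nx by (intro sum.cong) (auto simp: f_def)
    also have "\<dots> = 4 + real (card (E `` {y} \<inter> E `` {x}))"
      using fin yx by (simp add: sum.distrib sum.inter_restrict[symmetric] del: Image_singleton_iff)
    finally show ?thesis
      using vdegree_neighbour_split[of x y] y by simp
  qed
  have av: "(\<Sum>y \<in> E `` {x}. real (out_degree E x y)) = ?d * av_out_degree E x"
    using assms(1) by (simp add: av_out_degree_def)
  \<comment> \<open>The degrees of the neighbours cancel between the two sums, leaving only out
    degrees.\<close>
  have "4 * Gamma2_form E f f x
      = (\<Sum>y \<in> E `` {x}. 3 - ?d - real (out_degree E x y)) + 2 * ?d\<^sup>2"
    unfolding Gamma2_form_self L sum_subtractf[symmetric]
    by (intro arg_cong2[where f = "(+)"] sum.cong) (simp_all add: sq f1 f0 del: Image_singleton_iff)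
  also have "\<dots> = 2 * ?d * K0_infinity E x"
    unfolding sum_subtractf av
    by (simp add: K0_infinity_def algebra_simps power2_eq_square vdegree_def[symmetric])
  finally have "?s * ?d\<^sup>2 + K * (?d / 2) \<le> ?d / 2 * K0_infinity E x"
    using assms(2)[unfolded curvature_dimension_def, rule_format, of f]
    by (simp add: L G mult.commute)
  then have "(?d / 2) * (K + 2 * ?d * ?s) \<le> (?d / 2) * K0_infinity E x"
    by (simp add: algebra_simps power2_eq_square)
  then have "K + 2 * ?d * ?s \<le> K0_infinity E x"
    by (rule mult_left_le_imp_le) (use assms(1) in simp)
  then show ?thesis by simp
qed

text \<open>The admissible constants form a nonempty set bounded above, and each \<open>f\<close>
  imposes a closed condition on \<open>K\<close>, so the supremum is itself admissible and
  \<open>GREATEST\<close> denotes it.\<close>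

lemma curvature_dimension_curvature_function:
  assumes "vdegree E x \<ge> 1"
  shows "curvature_dimension E x N (curvature_function E x N)"
    and "curvature_dimension E x N K \<Longrightarrow> K \<le> curvature_function E x N"
proof -
  let ?A = "{K. curvature_dimension E x N K}" and ?s = "real_of_ereal (1 / N)"
  have ne: "?A \<noteq> {}" using ex_curvature_dimension by auto
  have bdd: "bdd_above ?A"
    using curvature_dimension_le_K0[OF assms] by (intro bdd_aboveI) auto
  have "?s * (laplacian E f x)\<^sup>2 + Sup ?A * Gamma_form E f f x \<le> Gamma2_form E f f x" for f
  proof (cases "Gamma_form E f f x = 0")
    \<comment> \<open>The term with \<open>K\<close> vanishes here, so any admissible constant
      already gives the claim.\<close>
    case True
    then show ?thesis
      using ne by (auto simp: curvature_dimension_def dest: spec[of _ f])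
  next
    case False
    then have pos: "Gamma_form E f f x > 0" using Gamma_form_nonneg[of E f x] by linarith
    have "Sup ?A \<le> (Gamma2_form E f f x - ?s * (laplacian E f x)\<^sup>2) / Gamma_form E f f x"
      using ne pos by (intro cSup_least) (auto simp: curvature_dimension_def pos_le_divide_eq
          le_diff_eq add.commute)
    then show ?thesis using pos by (simp add: pos_le_divide_eq)
  qed
  then have cd: "curvature_dimension E x N (Sup ?A)"
    by (simp add: curvature_dimension_def)
  have ub: "K \<le> Sup ?A" if "curvature_dimension E x N K" for K
    using that bdd by (auto intro: cSup_upper)
  have eq: "curvature_function E x N = Sup ?A"
    unfolding curvature_function_def using cd ub by (rule Greatest_equality)
  show "curvature_dimension E x N (curvature_function E x N)"
    using cd by (simp only: eq)
  show "curvature_dimension E x N K \<Longrightarrow> K \<le> curvature_function E x N"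
    using ub by (simp only: eq)
qed

section \<open>Dependence of the curvature on the dimension\<close>

lemma curvature_function_mono:
  assumes "vdegree E x \<ge> 1" and "real_of_ereal (1 / N) \<le> real_of_ereal (1 / M)"
  shows "curvature_function E x M \<le> curvature_function E x N"
  by (rule curvature_dimension_curvature_function(2)[OF assms(1)],
      rule curvature_dimension_mono[OF curvature_dimension_curvature_function(1)[OF assms(1)]
        order_refl assms(2)])

lemma curvature_function_shift:
  assumes "vdegree E x \<ge> 1" and "real_of_ereal (1 / M) \<le> real_of_ereal (1 / N)"
  shows "curvature_function E x M
      - 2 * real (vdegree E x) * (real_of_ereal (1 / N) - real_of_ereal (1 / M))
    \<le> curvature_function E x N"
  by (rule curvature_dimension_curvature_function(2)[OF assms(1)],
      rule curvature_dimension_shift[OF curvature_dimension_curvature_function(1)[OF assms(1)]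
        assms(2)])

text \<open>Monotonicity bounds the difference on one side and the shift on the other. Continuity,
  also at \<open>\<infinity>\<close>, thus reduces to that of the inverse dimension.\<close>

lemma curvature_function_Lipschitz:
  assumes "vdegree E x \<ge> 1"
  shows "\<bar>curvature_function E x M - curvature_function E x N\<bar>
    \<le> 2 * real (vdegree E x) * \<bar>real_of_ereal (1 / M) - real_of_ereal (1 / N)\<bar>"
proof (cases "real_of_ereal (1 / M) \<le> real_of_ereal (1 / N)")
  case True
  then show ?thesis
    using curvature_function_mono[OF assms True] curvature_function_shift[OF assms True] by simp
next
  case False
  then have *: "real_of_ereal (1 / N) \<le> real_of_ereal (1 / M)" by simp
  then show ?thesis
    using curvature_function_mono[OF assms *] curvature_function_shift[OF assms *] by simp
qed

lemma continuous_on_curvature_function: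
  assumes "vdegree E x \<ge> 1"
  shows "continuous_on {0<..} (curvature_function E x)"
  unfolding continuous_on_def
proof
  fix M :: ereal assume M: "M \<in> {0<..}"
  let ?F = "at M within {0<..}"
  \<comment> \<open>On \<open>{0<..}\<close>, which contains \<open>\<infinity>\<close>, the inverse
    is continuous with finite values, and \<open>real_of_ereal\<close> is continuous away from the
    infinities.\<close>
  have "continuous_on {0<..} (\<lambda>N :: ereal. real_of_ereal (inverse N))"
  proof (rule continuous_on_compose2[OF continuous_on_real])
    show "continuous_on {0<..} (inverse :: ereal \<Rightarrow> ereal)"
      by (rule continuous_on_subset[OF continuous_on_inverse_ereal]) auto
    show "inverse ` {0<..} \<subseteq> UNIV - {\<infinity>, - \<infinity> :: ereal}"
    proof safe
      fix N :: ereal assume "N > 0"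
      then show "inverse N = \<infinity> \<Longrightarrow> False" "inverse N = - \<infinity> \<Longrightarrow> False"
        by (cases N; simp split: if_splits)+
    qed simp
  qed
  then have "((\<lambda>N. real_of_ereal (1 / N)) \<longlongrightarrow> real_of_ereal (1 / M)) ?F"
    using M by (auto simp: continuous_on_def divide_ereal_def)
  then have lim: "((\<lambda>N. 2 * real (vdegree E x) * \<bar>real_of_ereal (1 / N) - real_of_ereal (1 / M)\<bar>)
      \<longlongrightarrow> 0) ?F"
    by (intro tendsto_mult_right_zero tendsto_rabs_zero LIM_zero)
  have "((\<lambda>N. curvature_function E x N - curvature_function E x M) \<longlongrightarrow> 0) ?F"
    by (rule Lim_null_comparison[OF _ lim]) (use curvature_function_Lipschitz[OF assms] in auto)
  then show "(curvature_function E x \<longlongrightarrow> curvature_function E x M) ?F"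
    by (simp add: Lim_null[symmetric])
qed

lemma filterlim_curvature_function:
  assumes "vdegree E x \<ge> 1"
  shows "filterlim (curvature_function E x) at_bot (at_right 0)"
  unfolding filterlim_at_bot
proof
  fix Z :: real
  let ?d = "real (vdegree E x)"
  \<comment> \<open>\<open>c\<close> is an inverse dimension at which the upper bound has dropped to
    \<open>Z\<close>; the maximum with 1 keeps it positive, so \<open>1 / c\<close> can serve as
    threshold for \<open>N\<close>.\<close>
  define c where "c = max 1 ((K0_infinity E x - Z) / (2 * ?d))"
  have c: "0 < c" "K0_infinity E x - 2 * ?d * c \<le> Z"
    using assms max.cobounded2[of "(K0_infinity E x - Z) / (2 * ?d)" 1]
    by (auto simp: c_def[symmetric] pos_divide_le_eq algebra_simps) (simp add: c_def)
  have "curvature_function E x N \<le> Z" if N: "0 < N" "N < ereal (1 / c)" for N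
  proof -
    obtain r where r: "N = ereal r" "0 < r" "r < 1 / c"
      using N by (cases N) auto
    have "c \<le> real_of_ereal (1 / N)"
      using r c(1) by (simp add: real_of_ereal_one_divide field_simps)
    then have "2 * ?d * c \<le> 2 * ?d * real_of_ereal (1 / N)"
      by (rule mult_left_mono) simp
    then show ?thesis
      using c(2) curvature_dimension_le_K0[OF assms curvature_dimension_curvature_function(1)[OF assms],
          of N] by linarith
  qed
  then show "\<forall>\<^sub>F N in at_right 0. curvature_function E x N \<le> Z"
    using c(1) eventually_at_right[of 0 "1 :: ereal"]
    by (auto intro!: exI[of _ "ereal (1 / c)"])
qed

text \<open>The maximal constants at \<open>s\<close> and \<open>t\<close> combine to an admissible
  one at the intermediate dimension, where the curvature is the largest.\<close>

lemma concave_on_curvature_function: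
  assumes "vdegree E x \<ge> 1"
  shows "concave_on {0<..} (\<lambda>t :: real. curvature_function E x (ereal t))"
  unfolding concave_on_iff real_scaleR_def
proof (intro conjI ballI allI impI)
  fix s t u v :: real
  assume "s \<in> {0<..}" "t \<in> {0<..}" "0 \<le> u" "0 \<le> v" "u + v = 1"
  then show "u * curvature_function E x (ereal s) + v * curvature_function E x (ereal t)
      \<le> curvature_function E x (ereal (u * s + v * t))"
    using curvature_dimension_curvature_function[OF assms]
    by (intro curvature_dimension_curvature_function(2)[OF assms] curvature_dimension_convex) auto
qed simp

end

text \<open>The first conjunct certifies that \<open>GREATEST\<close> in
  \<open>curvature_function\<close> is a true maximum, so that the other clauses speak of the
  intended value.\<close>

theorem proposition4p1:
  fixes V :: "'a set" and E :: "('a \<times> 'a) set" and x :: 'a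
  assumes "locally_finite_simple_graph V E"
    and "x \<in> V"
    and "vdegree E x \<ge> 1"
  shows "(\<forall>N > 0. curvature_dimension E x N (curvature_function E x N) \<and>
            (\<forall>K. curvature_dimension E x N K \<longrightarrow> K \<le> curvature_function E x N))
    \<and> mono_on {0<..} (curvature_function E x)
    \<and> continuous_on {0<..} (curvature_function E x)
    \<and> (\<forall>N > 0.
          curvature_function E x \<infinity> - 2 * real (vdegree E x) * real_of_ereal (1 / N)
            \<le> curvature_function E x N
        \<and> curvature_function E x N
            \<le> K0_infinity E x - 2 * real (vdegree E x) * real_of_ereal (1 / N))
    \<and> filterlim (curvature_function E x) at_bot (at_right 0)
    \<and> concave_on {0<..} (\<lambda>t :: real. curvature_function E x (ereal t))"
proof -
  interpret locally_finite_simple_graph V E by fact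
  note deg = \<open>vdegree E x \<ge> 1\<close>
  have mono: "mono_on {0<..} (curvature_function E x)"
    by (intro mono_onI curvature_function_mono[OF deg] inverse_dimension_antimono) auto
  \<comment> \<open>The shift starts from \<open>\<infinity>\<close>, whose inverse is 0.\<close>
  have lower: "curvature_function E x \<infinity> - 2 * real (vdegree E x) * real_of_ereal (1 / N)
      \<le> curvature_function E x N" if "N > 0" for N
    using curvature_function_shift[OF deg, of \<infinity> N] inverse_dimension_nonneg[OF that] by simp
  show ?thesis
    by (intro conjI allI impI mono lower continuous_on_curvature_function[OF deg]
        curvature_dimension_curvature_function[OF deg]
        curvature_dimension_le_K0[OF deg curvature_dimension_curvature_function(1)[OF deg]]
        filterlim_curvature_function[OF deg] concave_on_curvature_function[OF deg])
qed

end
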